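(* Let $k$ be a field, let $q\in k^{\times}$ be not a root of unity, and let $n\ge 0$ be an integer. Let $P\subset A^{(n)}$ be a prime ideal such that $\langle y,y',\dots,y^{(n)}\rangle\subset P$. Then $P$ is of the form $$P=\langle \psi_1(x,x',\dots,x^{(n)}),\dots,\psi_m(x,x',\dots,x^{(n)}),y,y',\dots,y^{(n)}\rangle,$$ where $\psi_i(x,x',\dots,x^{(n)})\in k[x,x',\dots,x^{(n)}]$ for $i=1,\dots,m$ generate a prime ideal of the commutative polynomial ring $k[x,x',\dots,x^{(n)}]$.
   Context: Let $B^{(n)}=k\langle x,x',\dots,x^{(n)},y,y',\dots,y^{(n)}\rangle$ be the free associative (noncommutative) unital $k$-algebra on the $2n+2$ indeterminates $x=x^{(0)},x'=x^{(1)},\dots,x^{(n)},y=y^{(0)},y'=y^{(1)},\dots,y^{(n)}$. Let $A^{(n)}$ be the quotient of $B^{(n)}$ by the two-sided ideal generated by all elements $x^{(i)}x^{(j)}-x^{(j)}x^{(i)}$, $\;y^{(i)}y^{(j)}-y^{(j)}y^{(i)}$, $\;y^{(i)}x^{(j)}-q\,x^{(j)}y^{(i)}$ for $0\le i,j\le n$. The variables $x,x',\dots,x^{(n)}$ commute with each other in $A^{(n)}$, so a polynomial in $k[x,x',\dots,x^{(n)}]$ defines an element of $A^{(n)}$. Ideals of $A^{(n)}$ are two-sided, and $\langle S\rangle$ denotes the two-sided ideal generated by a set $S$. An ideal $P$ is prime if $P\ne(1)$ and $ab\in P$ implies $a\in P$ or $b\in P$ for all elements $a,b$. *)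

theory Defs
  imports "HOL-Library.Poly_Mapping" "HOL-Algebra.QuotRing"
begin

(* The free monoid, written additively because the convolution product on
   \<^typ>\<open>'m \<Rightarrow>\<^sub>0 'k\<close> expects an additive monoid of exponents.  The wrapper
   keeps concatenation from becoming the global addition on lists. *)

datatype 'a free_mon = Word (letters: "'a list")

instantiation free_mon :: (type) monoid_add
begin

definition zero_free_mon :: "'a free_mon" where
  "0 = Word []"

definition plus_free_mon :: "'a free_mon \<Rightarrow> 'a free_mon \<Rightarrow> 'a free_mon" where
  "u + v = Word (letters u @ letters v)"

instance
  by standard (simp_all add: zero_free_mon_def plus_free_mon_def)

end

definition monoid_alg :: "'m set \<Rightarrow> ('m::monoid_add \<Rightarrow>\<^sub>0 'k::comm_ring_1) ring" where
  "monoid_alg M =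
    \<lparr>carrier = {p. Poly_Mapping.keys p \<subseteq> M}, mult = (*), one = 1, zero = 0, add = (+)\<rparr>"

lemma monoid_alg_simps [simp]:
  "carrier (monoid_alg M) = {p. Poly_Mapping.keys p \<subseteq> M}"
  "a \<otimes>\<^bsub>monoid_alg M\<^esub> b = a * b"
  "a \<oplus>\<^bsub>monoid_alg M\<^esub> b = a + b"
  "\<one>\<^bsub>monoid_alg M\<^esub> = 1"
  "\<zero>\<^bsub>monoid_alg M\<^esub> = 0"
  by (simp_all add: monoid_alg_def)

lemma ring_monoid_alg:
  assumes "0 \<in> M" "\<And>a b. a \<in> M \<Longrightarrow> b \<in> M \<Longrightarrow> a + b \<in> M"
  shows "ring (monoid_alg M :: ('m::monoid_add \<Rightarrow>\<^sub>0 'k::comm_ring_1) ring)"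
proof (rule ringI)
  show "abelian_group (monoid_alg M :: ('m \<Rightarrow>\<^sub>0 'k) ring)"
  proof (rule abelian_groupI)
    fix x y :: "'m \<Rightarrow>\<^sub>0 'k"
    assume "x \<in> carrier (monoid_alg M)" "y \<in> carrier (monoid_alg M)"
    then show "x \<oplus>\<^bsub>monoid_alg M\<^esub> y \<in> carrier (monoid_alg M)"
      using keys_add[of x y] by auto
  next
    fix x :: "'m \<Rightarrow>\<^sub>0 'k"
    assume "x \<in> carrier (monoid_alg M)"
    then show "\<exists>y\<in>carrier (monoid_alg M). y \<oplus>\<^bsub>monoid_alg M\<^esub> x = \<zero>\<^bsub>monoid_alg M\<^esub>"
      by (intro bexI[of _ "- x"]) simp_all
  qed (simp_all add: add_ac)
  show "Group.monoid (monoid_alg M :: ('m \<Rightarrow>\<^sub>0 'k) ring)"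
  proof (rule monoidI)
    fix x y :: "'m \<Rightarrow>\<^sub>0 'k"
    assume "x \<in> carrier (monoid_alg M)" "y \<in> carrier (monoid_alg M)"
    then show "x \<otimes>\<^bsub>monoid_alg M\<^esub> y \<in> carrier (monoid_alg M)"
      using keys_mult[of x y] assms(2) by simp blast
  qed (use assms(1) in \<open>simp_all add: mult.assoc\<close>)
qed (simp_all add: algebra_simps)

lemma cring_monoid_alg:
  assumes "0 \<in> M" "\<And>a b. a \<in> M \<Longrightarrow> b \<in> M \<Longrightarrow> a + b \<in> M"
  shows "cring (monoid_alg M :: ('m::comm_monoid_add \<Rightarrow>\<^sub>0 'k::comm_ring_1) ring)"
proof -
  interpret ring "monoid_alg M :: ('m \<Rightarrow>\<^sub>0 'k) ring"
    using assms by (rule ring_monoid_alg)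
  show ?thesis
    by unfold_locales (simp add: mult.commute)
qed

(* X i and Y i stand for the i-th derivatives of x and y. *)

datatype letter = X nat | Y nat

abbreviation gen :: "letter \<Rightarrow> letter free_mon \<Rightarrow>\<^sub>0 'k::comm_ring_1" where
  "gen l \<equiv> Poly_Mapping.single (Word [l]) 1"

definition free_alg :: "nat \<Rightarrow> (letter free_mon \<Rightarrow>\<^sub>0 'k::comm_ring_1) ring" where
  "free_alg n = monoid_alg {w. set (letters w) \<subseteq> X ` {..n} \<union> Y ` {..n}}"

lemma ring_free_alg: "ring (free_alg n)"
  unfolding free_alg_def
  by (rule ring_monoid_alg) (auto simp: zero_free_mon_def plus_free_mon_def)

(* The factor q is written as the scalar q * 1, that is, the single term with
   coefficient q at the empty word. *)

definition q_relations :: "'k::comm_ring_1 \<Rightarrow> nat \<Rightarrow> (letter free_mon \<Rightarrow>\<^sub>0 'k) set" where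
  "q_relations q n =
     {gen (X i) * gen (X j) - gen (X j) * gen (X i) | i j. i \<le> n \<and> j \<le> n} \<union>
     {gen (Y i) * gen (Y j) - gen (Y j) * gen (Y i) | i j. i \<le> n \<and> j \<le> n} \<union>
     {gen (Y i) * gen (X j) - Poly_Mapping.single 0 q * (gen (X j) * gen (Y i))
        | i j. i \<le> n \<and> j \<le> n}"

definition q_ideal :: "'k::comm_ring_1 \<Rightarrow> nat \<Rightarrow> (letter free_mon \<Rightarrow>\<^sub>0 'k) set" where
  "q_ideal q n = Idl\<^bsub>free_alg n\<^esub> (q_relations q n)"

definition q_alg :: "'k::comm_ring_1 \<Rightarrow> nat \<Rightarrow> (letter free_mon \<Rightarrow>\<^sub>0 'k) set ring" where
  "q_alg q n = free_alg n Quot q_ideal q n"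

lemma gen_closed:
  "i \<le> n \<Longrightarrow> (gen (X i) :: letter free_mon \<Rightarrow>\<^sub>0 'k::comm_ring_1) \<in> carrier (free_alg n)"
  "i \<le> n \<Longrightarrow> (gen (Y i) :: letter free_mon \<Rightarrow>\<^sub>0 'k::comm_ring_1) \<in> carrier (free_alg n)"
  by (auto simp: free_alg_def)

lemma q_relations_closed: "q_relations q n \<subseteq> carrier (free_alg n)"
proof -
  interpret ring "free_alg n :: (letter free_mon \<Rightarrow>\<^sub>0 'a) ring"
    by (rule ring_free_alg)
  have mult: "a * b \<in> carrier (free_alg n)"
    if "a \<in> carrier (free_alg n)" "b \<in> carrier (free_alg n)"
    for a b :: "letter free_mon \<Rightarrow>\<^sub>0 'a"
    using m_closed[OF that] by (simp add: free_alg_def)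
  have diff: "a - b \<in> carrier (free_alg n)"
    if "a \<in> carrier (free_alg n)" "b \<in> carrier (free_alg n)"
    for a b :: "letter free_mon \<Rightarrow>\<^sub>0 'a"
    using that order_trans[OF keys_diff[of a b]] by (simp add: free_alg_def)
  have scal: "Poly_Mapping.single 0 q \<in> carrier (free_alg n)"
    by (auto simp: free_alg_def zero_free_mon_def)
  show ?thesis
    unfolding q_relations_def by (auto intro!: mult diff scal gen_closed)
qed

lemma ideal_q_ideal: "ideal (q_ideal q n) (free_alg n)"
  unfolding q_ideal_def by (rule ring.genideal_ideal[OF ring_free_alg q_relations_closed])

lemma ring_q_alg: "ring (q_alg q n)"
  unfolding q_alg_def by (rule ideal.quotient_is_ring[OF ideal_q_ideal])

definition y_elt :: "'k::comm_ring_1 \<Rightarrow> nat \<Rightarrow> nat \<Rightarrow> (letter free_mon \<Rightarrow>\<^sub>0 'k) set" where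
  "y_elt q n i = q_ideal q n +>\<^bsub>free_alg n\<^esub> gen (Y i)"

definition comm_poly_ring :: "nat \<Rightarrow> ((nat \<Rightarrow>\<^sub>0 nat) \<Rightarrow>\<^sub>0 'k::comm_ring_1) ring" where
  "comm_poly_ring n = monoid_alg {m. Poly_Mapping.keys m \<subseteq> {..n}}"

lemma cring_comm_poly_ring: "cring (comm_poly_ring n)"
  unfolding comm_poly_ring_def
proof (rule cring_monoid_alg)
  fix a b :: "nat \<Rightarrow>\<^sub>0 nat"
  assume "a \<in> {m. Poly_Mapping.keys m \<subseteq> {..n}}" "b \<in> {m. Poly_Mapping.keys m \<subseteq> {..n}}"
  then show "a + b \<in> {m. Poly_Mapping.keys m \<subseteq> {..n}}"
    using keys_add[of a b] by blast
qed simp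

(* A commutative polynomial is read in the quotient by writing each monomial as
   the word X 0 ... X 0 X 1 ... X 1 ... X n.  Since the X i commute modulo
   q_ideal, the chosen order of the factors is immaterial. *)

definition x_word :: "nat \<Rightarrow> (nat \<Rightarrow>\<^sub>0 nat) \<Rightarrow> letter free_mon" where
  "x_word n m = Word (concat (map (\<lambda>i. replicate (Poly_Mapping.lookup m i) (X i)) [0..<Suc n]))"

definition poly_elt ::
  "'k::comm_ring_1 \<Rightarrow> nat \<Rightarrow> ((nat \<Rightarrow>\<^sub>0 nat) \<Rightarrow>\<^sub>0 'k) \<Rightarrow> (letter free_mon \<Rightarrow>\<^sub>0 'k) set" where
  "poly_elt q n p = q_ideal q n +>\<^bsub>free_alg n\<^esub>
     (\<Sum>m\<in>Poly_Mapping.keys p. Poly_Mapping.single (x_word n m) (Poly_Mapping.lookup p m))"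

(* Primeness tested on elements; the library's primeideal demands a
   commutative ring. *)

definition completely_prime_ideal :: "'a set \<Rightarrow> ('a, 'b) ring_scheme \<Rightarrow> bool" where
  "completely_prime_ideal P R \<longleftrightarrow>
     ideal P R \<and> P \<noteq> carrier R \<and>
     (\<forall>a\<in>carrier R. \<forall>b\<in>carrier R. a \<otimes>\<^bsub>R\<^esub> b \<in> P \<longrightarrow> a \<in> P \<or> b \<in> P)"

end

theory Submission
  imports Defs "HOL-Algebra.Ring_Divisibility"
begin

text \<open>The quotient of the algebra by the ideal of the \<open>Y i\<close> is the commutative polynomial ring
  in the \<open>X i\<close>, so ideals that contain all the \<open>Y i\<close> correspond to ideals of
  that ring, prime ones to prime ones, and the latter are finitely generated by Hilbert's basis
  theorem.

  The correspondence is realised without forming this further quotient. Setting the \<open>Y i\<close>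
  to zero and letting the \<open>X i\<close> commute is a surjective homomorphism \<open>x_part\<close> from the
  free algebra, with a linear section \<open>x_lift\<close> that writes monomials as sorted words. The
  heart of the matter is \<open>normal_form\<close>: an element \<open>a\<close> of the free algebra differs from
  \<open>x_lift n (x_part a)\<close> only by an element of the ideal generated by the commutators of the
  \<open>X i\<close> and the \<open>Y i\<close>, since a word either contains some \<open>Y i\<close> or can be
  sorted. Therefore membership of a coset in an ideal \<open>Q\<close> that contains the \<open>Y i\<close>
  depends on the commutative image alone (\<open>coset_mem_iff_x_part\<close>). This yields that the
  contraction of \<open>Q\<close> to the polynomial ring is an ideal, prime if \<open>Q\<close> is, and that
  inclusion of contractions implies inclusion of the ideals.

  Now let \<open>J\<close> be the contraction of \<open>P\<close>, generated by a finite set \<open>G\<close>. The ideal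
  generated by the images of \<open>G\<close> and the \<open>Y i\<close> lies in \<open>P\<close>, and its contraction
  contains \<open>G\<close>, hence \<open>J\<close>; so it also contains \<open>P\<close>.

  Hilbert's basis theorem is proved for polynomials as finitely supported functions on exponent
  vectors, from Dickson's lemma and the lexicographic order.\<close>

section \<open>Dickson's lemma and the lexicographic order\<close>

lemma nat_seq_incseq_subseq:
  fixes s :: "nat \<Rightarrow> nat"
  shows "\<exists>g::nat \<Rightarrow> nat. strict_mono g \<and> incseq (\<lambda>k. s (g k))"
proof -
  obtain g :: "nat \<Rightarrow> nat" where g: "strict_mono g" "monoseq (\<lambda>k. s (g k))"
    using seq_monosub by blast
  show ?thesis
  proof (cases "incseq (\<lambda>k. s (g k))")
    case True
    with g show ?thesis by blast
  next
    case False
    then have dec: "decseq (\<lambda>k. s (g k))"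
      using g(2) monoseq_iff by blast
    define k0 where "k0 = (ARG_MIN (\<lambda>k. s (g k)) k. True)"
    have min: "s (g k0) \<le> s (g k)" for k
      unfolding k0_def by (rule arg_min_nat_le) simp
    have "s (g (k0 + k)) = s (g k0)" for k
      using min[of "k0 + k"] dec by (intro antisym) (auto simp: decseq_def)
    moreover have "strict_mono (\<lambda>k. g (k0 + k))"
      using g(1) by (auto simp: strict_mono_def)
    ultimately show ?thesis
      by (intro exI[of _ "\<lambda>k. g (k0 + k)"]) (simp add: incseq_def)
  qed
qed

text \<open>Thinning out the sequence once per coordinate keeps the monotonicity already
  obtained, since a subsequence of a monotone sequence is monotone.\<close>

lemma incseq_subseq_finitely_many_coords:
  fixes s :: "nat \<Rightarrow> nat \<Rightarrow> nat"
  shows "\<exists>g::nat \<Rightarrow> nat. strict_mono g \<and> (\<forall>i<N. incseq (\<lambda>k. s (g k) i))"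
proof (induction N)
  case 0
  show ?case by (intro exI[of _ id]) (simp add: strict_mono_def)
next
  case (Suc N)
  then obtain g :: "nat \<Rightarrow> nat" where g: "strict_mono g" "\<And>i. i < N \<Longrightarrow> incseq (\<lambda>k. s (g k) i)"
    by blast
  obtain h :: "nat \<Rightarrow> nat" where h: "strict_mono h" "incseq (\<lambda>k. s (g (h k)) N)"
    using nat_seq_incseq_subseq[of "\<lambda>k. s (g k) N"] by blast
  have "incseq (\<lambda>k. s (g (h k)) i)" if "i < Suc N" for i
  proof (cases "i = N")
    case False
    then show ?thesis
      using g(2)[of i] h(1) that
      by (auto simp: incseq_def strict_mono_less_eq)
  qed (use h in simp)
  moreover have "strict_mono (\<lambda>k. g (h k))"
    using g(1) h(1) by (simp add: strict_mono_def)
  ultimately show ?case by blast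
qed

text \<open>In the divisibility form \<^term>\<open>s j = s i + d\<close> the lemma serves twice: it bounds the
  number of minimal monomials, and it rules out infinite lexicographic descent, a multiple of a
  monomial being never lexicographically smaller than the monomial itself.\<close>

lemma dickson:
  fixes s :: "nat \<Rightarrow> nat \<Rightarrow>\<^sub>0 nat"
  assumes "\<And>k. Poly_Mapping.keys (s k) \<subseteq> {..n}"
  shows "\<exists>i j d. i < j \<and> s j = s i + d"
proof -
  obtain g :: "nat \<Rightarrow> nat"
    where g: "strict_mono g" "\<And>i. i < Suc n \<Longrightarrow> incseq (\<lambda>k. Poly_Mapping.lookup (s (g k)) i)"
    using incseq_subseq_finitely_many_coords[of "Suc n" "\<lambda>k. Poly_Mapping.lookup (s k)"] by blast
  have "Poly_Mapping.lookup (s (g 0)) i \<le> Poly_Mapping.lookup (s (g 1)) i" for i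
  proof (cases "i < Suc n")
    case True
    from g(2)[OF this] show ?thesis by (simp add: incseq_def)
  next
    case False
    then have "i \<notin> Poly_Mapping.keys (s (g 0))" using assms[of "g 0"] by auto
    then show ?thesis by (simp add: in_keys_iff)
  qed
  then have "s (g 1) = s (g 0) + (s (g 1) - s (g 0))"
    by (intro poly_mapping_eqI) (simp add: lookup_add lookup_minus)
  moreover have "g 0 < g 1" using g(1) by (simp add: strict_mono_def)
  ultimately show ?thesis by blast
qed

lemma monomial_zero_le: "0 \<le> (d :: nat \<Rightarrow>\<^sub>0 nat)"
proof -
  have "\<not> d < 0"
    by transfer (simp add: less_fun_def)
  then show ?thesis by simp
qed

text \<open>The restriction to finitely many variables is essential: with all variables available,
  $x_0 > x_1 > x_2 > \dots$ is an infinite descent.\<close>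

lemma wf_lex_monomials:
  "wf {(a, b :: nat \<Rightarrow>\<^sub>0 nat). a < b \<and> Poly_Mapping.keys a \<subseteq> {..n} \<and> Poly_Mapping.keys b \<subseteq> {..n}}"
  unfolding wf_iff_no_infinite_down_chain
proof
  assume "\<exists>f. \<forall>i. (f (Suc i), f i) \<in>
    {(a, b :: nat \<Rightarrow>\<^sub>0 nat). a < b \<and> Poly_Mapping.keys a \<subseteq> {..n} \<and> Poly_Mapping.keys b \<subseteq> {..n}}"
  then obtain f :: "nat \<Rightarrow> nat \<Rightarrow>\<^sub>0 nat"
    where dec: "\<And>i. f (Suc i) < f i" and k: "\<And>i. Poly_Mapping.keys (f i) \<subseteq> {..n}"
    by auto
  obtain i j d where ij: "i < j" "f j = f i + d"
    using dickson[OF k] by blast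
  have "f j < f i"
    using ij(1) by (induction j) (auto simp: less_Suc_eq dec intro: order.strict_trans[OF dec])
  moreover have "f i \<le> f i + d"
    using add_left_mono[OF monomial_zero_le, of "f i" d] by simp
  ultimately show False
    using ij(2) by simp
qed

text \<open>The minimal elements for divisibility form an antichain, which Dickson's lemma forces to be
  finite. Below every element lies a minimal one, because proper divisors are lexicographically
  smaller.\<close>

lemma finite_divisor_basis:
  fixes L :: "(nat \<Rightarrow>\<^sub>0 nat) set"
  assumes L: "\<And>m. m \<in> L \<Longrightarrow> Poly_Mapping.keys m \<subseteq> {..n}"
  shows "\<exists>F\<subseteq>L. finite F \<and> (\<forall>m\<in>L. \<exists>f\<in>F. \<exists>d. m = f + d)"
proof -
  define F where "F = {m \<in> L. \<forall>f\<in>L. \<forall>d. m = f + d \<longrightarrow> f = m}"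
  have "finite F"
  proof (rule ccontr)
    assume "infinite F"
    then obtain s :: "nat \<Rightarrow> nat \<Rightarrow>\<^sub>0 nat" where s: "inj s" "range s \<subseteq> F"
      using infinite_countable_subset by blast
    obtain i j d where ij: "i < j" "s j = s i + d"
      using dickson[of s n] s(2) L unfolding F_def by blast
    then have "s i = s j"
      using s(2) unfolding F_def by blast
    with ij(1) s(1) show False
      by (auto dest: injD)
  qed
  moreover have "\<exists>f\<in>F. \<exists>d. m = f + d" if "m \<in> L" for m
    using wf_lex_monomials[of n] that
  proof (induction m rule: wf_induct_rule)
    case (less m)
    show ?case
    proof (cases "m \<in> F")
      case True
      then show ?thesis by (metis add.right_neutral)
    next
      case False
      then obtain f d where f: "f \<in> L" "m = f + d" "f \<noteq> m"
        using less.prems unfolding F_def by blast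
      have "f \<le> m"
        using add_left_mono[OF monomial_zero_le, of f d] f(2) by simp
      then obtain f' d' where "f' \<in> F" "f = f' + d'"
        using less.IH[of f] less.prems f L by force
      then show ?thesis
        using f(2) by (metis add.assoc)
    qed
  qed
  ultimately show ?thesis
    unfolding F_def by blast
qed

section \<open>Hilbert's basis theorem\<close>

text \<open>Since addition of exponents is cancellative, the coefficient of a shifted monomial in a
  monomial multiple has exactly one contribution.\<close>

lemma lookup_single_mult_shift:
  fixes d :: "'m::cancel_comm_monoid_add" and g :: "'m \<Rightarrow>\<^sub>0 'k::semiring_0"
  shows "Poly_Mapping.lookup (Poly_Mapping.single d c * g) (d + k) = c * Poly_Mapping.lookup g k"
proof -
  have "Poly_Mapping.lookup (Poly_Mapping.single d c * g) (d + k) =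
    (\<Sum>l. (c * (\<Sum>q. Poly_Mapping.lookup g q when d + k = l + q)) when l = d)"
    unfolding lookup_mult by (rule Sum_any.cong) (simp add: lookup_single when_def)
  also have "\<dots> = c * (\<Sum>q. Poly_Mapping.lookup g q when q = k)"
    by (simp add: eq_commute[of k])
  finally show ?thesis by simp
qed

text \<open>Bridges the additive inverse of the ring record, known to the theory of ideals, and the
  type-class subtraction in which the computations below are carried out.\<close>

lemma monoid_alg_minus_closed:
  fixes I :: "('m::monoid_add \<Rightarrow>\<^sub>0 'k::comm_ring_1) set"
  assumes "ideal I (monoid_alg M)" "a \<in> I" "b \<in> I"
  shows "a - b \<in> I"
proof -
  interpret I: ideal I "monoid_alg M" by fact
  have "b \<in> carrier (monoid_alg M)" using assms(3) by (rule I.Icarr)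
  then have "\<ominus>\<^bsub>monoid_alg M\<^esub> b = - b"
    by (intro I.minus_equality) simp_all
  then show ?thesis
    using additive_subgroup.a_closed[OF I.additive_subgroup_axioms assms(2)]
      additive_subgroup.a_inv_closed[OF I.additive_subgroup_axioms assms(3)]
    by (metis diff_conv_add_uminus monoid_alg_simps(3))
qed

text \<open>Gordan's proof. Among the leading monomials of an ideal, finitely many divide all the others;
  let \<open>G\<close> consist of one element of the ideal for each of these. Any nonzero element of the
  ideal can then have its leading term cancelled by a monomial multiple of an element of \<open>G\<close>,
  and the remainder is again in the ideal with a smaller leading monomial, so that well-founded
  induction reduces it to zero.\<close>

theorem hilbert_basis: "noetherian_ring (comm_poly_ring n :: ((nat \<Rightarrow>\<^sub>0 nat) \<Rightarrow>\<^sub>0 'k::field) ring)"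
proof -
  let ?R = "comm_poly_ring n :: ((nat \<Rightarrow>\<^sub>0 nat) \<Rightarrow>\<^sub>0 'k) ring"
  interpret cring ?R by (rule cring_comm_poly_ring)
  have R: "p \<in> carrier ?R \<longleftrightarrow> (\<forall>m\<in>Poly_Mapping.keys p. Poly_Mapping.keys m \<subseteq> {..n})" for p
    by (auto simp: comm_poly_ring_def)
  define lm :: "((nat \<Rightarrow>\<^sub>0 nat) \<Rightarrow>\<^sub>0 'k) \<Rightarrow> nat \<Rightarrow>\<^sub>0 nat" where "lm p = Max (Poly_Mapping.keys p)" for p
  have lm_key: "lm p \<in> Poly_Mapping.keys p" if "p \<noteq> 0" for p
    using that by (simp add: lm_def)
  have lm_max: "m \<le> lm p" if "m \<in> Poly_Mapping.keys p" for m p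
    using that by (simp add: lm_def)
  show ?thesis
  proof (rule noetherian_ringI)
    fix I assume I: "ideal I ?R"
    interpret I: ideal I ?R by (rule I)
    define L where "L = lm ` (I - {0})"
    have "Poly_Mapping.keys m \<subseteq> {..n}" if "m \<in> L" for m
      using that I.Icarr lm_key unfolding L_def R by blast
    then obtain F where F: "F \<subseteq> L" "finite F" "\<And>m. m \<in> L \<Longrightarrow> \<exists>f\<in>F. \<exists>d. m = f + d"
      using finite_divisor_basis[of L n] by blast
    obtain G where G: "G \<subseteq> I - {0}" "finite G" "F = lm ` G"
      using finite_subset_image[OF F(2) F(1)[unfolded L_def]] by blast
    have Gcarr: "G \<subseteq> carrier ?R" using G(1) I.Icarr by blast
    interpret J: ideal "Idl\<^bsub>?R\<^esub> G" ?R by (rule genideal_ideal[OF Gcarr])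
    have "p \<in> Idl\<^bsub>?R\<^esub> G" if "p \<in> I" "p \<noteq> 0" for p
      using wf_lex_monomials[of n] that
    proof (induction "lm p" arbitrary: p rule: wf_induct_rule)
      case less
      have pR: "p \<in> carrier ?R" using less.prems(1) by (rule I.Icarr)
      have "lm p \<in> L" using less.prems unfolding L_def by blast
      then obtain g d where g: "g \<in> G" "lm p = lm g + d"
        using F(3) G(3) by blast
      have g0: "g \<noteq> 0" and gI: "g \<in> I" using g(1) G(1) by auto
      \<comment> \<open>The multiple \<open>r * g\<close> has the same leading term as \<open>p\<close>.\<close>
      define c where "c = Poly_Mapping.lookup p (lm p) / Poly_Mapping.lookup g (lm g)"
      define r where "r = Poly_Mapping.single d c"
      have "Poly_Mapping.keys d \<subseteq> Poly_Mapping.keys (lm p)"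
        using g(2) by (auto simp: in_keys_iff lookup_add)
      then have "Poly_Mapping.keys d \<subseteq> {..n}"
        using pR lm_key[OF less.prems(2)] unfolding R by blast
      then have rR: "r \<in> carrier ?R"
        unfolding R r_def by simp
      define p' where "p' = p - r * g"
      have rgI: "r * g \<in> I" and rgJ: "r * g \<in> Idl\<^bsub>?R\<^esub> G"
        using I.I_l_closed[OF gI rR] J.I_l_closed[OF _ rR] genideal_self[OF Gcarr] g(1)
        by (auto simp: comm_poly_ring_def)
      have p'I: "p' \<in> I"
        unfolding p'_def using I less.prems(1) rgI
        unfolding comm_poly_ring_def by (rule monoid_alg_minus_closed)
      have "p' \<in> Idl\<^bsub>?R\<^esub> G"
      proof (cases "p' = 0")
        case True
        then show ?thesis using J.zero_closed by (simp add: comm_poly_ring_def)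
      next
        case False
        have le: "m \<le> lm p" if m: "m \<in> Poly_Mapping.keys (r * g)" for m
        proof -
          obtain k where "k \<in> Poly_Mapping.keys g" "m = d + k"
            using keys_mult[of r g] m by (auto simp: r_def split: if_splits)
          then show ?thesis
            using lm_max[of k g] g(2) by (simp add: add.commute[of d])
        qed
        have "Poly_Mapping.lookup (r * g) (lm p) = Poly_Mapping.lookup p (lm p)"
          using lm_key[OF g0] lookup_single_mult_shift[of d c g "lm g"] g(2)
          by (simp add: r_def c_def add.commute in_keys_iff)
        then have "lm p \<notin> Poly_Mapping.keys p'"
          by (simp add: p'_def in_keys_iff lookup_minus)
        moreover have "lm p' \<le> lm p"
          using keys_diff[of p "r * g"] lm_key[OF False] le lm_max unfolding p'_def by blast
        ultimately have "lm p' < lm p"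
          using lm_key[OF False] by (metis order.not_eq_order_implies_strict)
        moreover have "Poly_Mapping.keys (lm p) \<subseteq> {..n}" "Poly_Mapping.keys (lm p') \<subseteq> {..n}"
          using pR I.Icarr[OF p'I] lm_key less.prems(2) False unfolding R by blast+
        ultimately show ?thesis
          using less.hyps[of p'] p'I False by simp
      qed
      moreover have "p = p' + r * g" by (simp add: p'_def)
      ultimately show ?case
        using J.a_closed[OF _ rgJ] by (simp add: comm_poly_ring_def)
    qed
    then have "I \<subseteq> Idl\<^bsub>?R\<^esub> G"
      using J.zero_closed by (auto simp: comm_poly_ring_def)
    moreover have "Idl\<^bsub>?R\<^esub> G \<subseteq> I"
      using genideal_minimal[OF I] G(1) by blast
    ultimately show "\<exists>A\<subseteq>carrier ?R. finite A \<and> I = Idl\<^bsub>?R\<^esub> A"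
      using Gcarr G(2) by blast
  qed
qed

section \<open>Linear extension from a basis of monomials\<close>

lemma poly_mapping_additive_induct [case_names single add]:
  fixes p :: "'m \<Rightarrow>\<^sub>0 'k::comm_monoid_add"
  assumes single: "\<And>w c. Q (Poly_Mapping.single w c)"
    and add: "\<And>p r. Q p \<Longrightarrow> Q r \<Longrightarrow> Q (p + r)"
  shows "Q p"
proof (induction p rule: update_induct)
  case const
  show ?case using single[of _ 0] by simp
next
  case (update f a b)
  have "Poly_Mapping.update a b f = f + Poly_Mapping.single a b"
    using update(1)
    by (intro poly_mapping_eqI) (auto simp: lookup_update lookup_add lookup_single in_keys_iff)
  with update(3) single add show ?case by simp
qed

definition lin_ext ::
  "('m \<Rightarrow> ('n::monoid_add \<Rightarrow>\<^sub>0 'k::comm_ring_1)) \<Rightarrow> ('m \<Rightarrow>\<^sub>0 'k) \<Rightarrow> ('n \<Rightarrow>\<^sub>0 'k)" where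
  "lin_ext f p = (\<Sum>w\<in>Poly_Mapping.keys p. Poly_Mapping.single 0 (Poly_Mapping.lookup p w) * f w)"

lemma lin_ext_single [simp]: "lin_ext f (Poly_Mapping.single w c) = Poly_Mapping.single 0 c * f w"
  by (simp add: lin_ext_def)

lemma lin_ext_add: "lin_ext f (p + r) = lin_ext f p + lin_ext f r"
  unfolding lin_ext_def
  by (rule setsum_keys_plus_distrib[where f = "\<lambda>w c. Poly_Mapping.single 0 c * f w"])
    (simp_all add: single_add distrib_right)

lemma lin_ext_scale:
  fixes p :: "'m::monoid_add \<Rightarrow>\<^sub>0 'k::comm_ring_1"
  shows "lin_ext f (Poly_Mapping.single 0 c * p) = Poly_Mapping.single 0 c * lin_ext f p"
proof (induction p rule: poly_mapping_additive_induct)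
  case (single w d)
  show ?case by (simp add: mult_single mult.assoc[symmetric])
qed (simp add: lin_ext_add distrib_left)

lemma lin_ext_comp:
  fixes f :: "'m \<Rightarrow> ('n::monoid_add \<Rightarrow>\<^sub>0 'k::comm_ring_1)"
  shows "lin_ext g (lin_ext f p) = lin_ext (\<lambda>w. lin_ext g (f w)) p"
  by (induction p rule: poly_mapping_additive_induct) (simp_all add: lin_ext_add lin_ext_scale)

lemma lin_ext_monomials: "lin_ext (\<lambda>w. Poly_Mapping.single w 1) p = p"
  by (induction p rule: poly_mapping_additive_induct) (simp_all add: lin_ext_add mult_single)

lemma lin_ext_cong:
  "(\<And>w. w \<in> Poly_Mapping.keys p \<Longrightarrow> f w = g w) \<Longrightarrow> lin_ext f p = lin_ext g p"
  unfolding lin_ext_def by (auto intro: sum.cong)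

lemma lin_ext_diff: "lin_ext (\<lambda>w. f w - g w) p = lin_ext f p - lin_ext g p"
  by (simp add: lin_ext_def right_diff_distrib sum_subtractf)

text \<open>The universal property of a monoid algebra, for commutative targets: there the scalars can
  be moved past the values of \<open>f\<close>.\<close>

lemma lin_ext_mult:
  fixes f :: "'m::monoid_add \<Rightarrow> ('n::comm_monoid_add \<Rightarrow>\<^sub>0 'k::comm_ring_1)"
  assumes f: "\<And>u v. f (u + v) = f u * f v"
  shows "lin_ext f (p * r) = lin_ext f p * lin_ext f r"
proof (induction p rule: poly_mapping_additive_induct)
  case (single u c)
  show ?case
  proof (induction r rule: poly_mapping_additive_induct)
    case (single v d)
    have "Poly_Mapping.single 0 (c * d) = Poly_Mapping.single 0 c * (Poly_Mapping.single 0 d :: 'n \<Rightarrow>\<^sub>0 'k)"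
      by (simp add: mult_single)
    then show ?case by (simp add: mult_single f mult_ac)
  qed (simp add: lin_ext_add distrib_left)
qed (simp add: lin_ext_add distrib_right)

text \<open>Membership of a linear extension in an ideal has to be tested on basis monomials only. It is
  used with an ideal of relations, and also with the whole carrier, to see that an extension takes
  values there.\<close>

lemma lin_ext_mem_ideal:
  fixes f :: "'w \<Rightarrow> ('m::monoid_add \<Rightarrow>\<^sub>0 'k::comm_ring_1)"
  assumes I: "ideal I (monoid_alg M)" and M: "0 \<in> M"
    and f: "\<And>w. w \<in> Poly_Mapping.keys p \<Longrightarrow> f w \<in> I"
  shows "lin_ext f p \<in> I"
proof -
  interpret I: ideal I "monoid_alg M" by (rule I)
  have "(\<Sum>w\<in>W. Poly_Mapping.single 0 (Poly_Mapping.lookup p w) * f w) \<in> I"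
    if "finite W" "W \<subseteq> Poly_Mapping.keys p" for W
    using that
  proof (induction W rule: finite_induct)
    case empty
    then show ?case using additive_subgroup.zero_closed[OF I.additive_subgroup_axioms] by simp
  next
    case (insert w W)
    have "Poly_Mapping.single 0 (Poly_Mapping.lookup p w) * f w \<in> I"
      using I.I_l_closed[OF f, of w "Poly_Mapping.single 0 (Poly_Mapping.lookup p w)"] insert.prems M
      by simp
    then show ?case
      using additive_subgroup.a_closed[OF I.additive_subgroup_axioms] insert by simp
  qed
  then show ?thesis unfolding lin_ext_def by simp
qed

section \<open>The commutative image of the free algebra\<close>

primrec letter_poly :: "letter \<Rightarrow> (nat \<Rightarrow>\<^sub>0 nat) \<Rightarrow>\<^sub>0 'k::comm_ring_1" where
  "letter_poly (X i) = Poly_Mapping.single (Poly_Mapping.single i 1) 1"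
| "letter_poly (Y i) = 0"

definition word_poly :: "letter free_mon \<Rightarrow> (nat \<Rightarrow>\<^sub>0 nat) \<Rightarrow>\<^sub>0 'k::comm_ring_1" where
  "word_poly w = prod_list (map letter_poly (letters w))"

text \<open>Evaluation of noncommutative polynomials at commuting variables, with every \<open>Y i\<close> set
  to zero. It annihilates all defining relations and all \<open>Y i\<close>.\<close>

definition x_part :: "(letter free_mon \<Rightarrow>\<^sub>0 'k::comm_ring_1) \<Rightarrow> (nat \<Rightarrow>\<^sub>0 nat) \<Rightarrow>\<^sub>0 'k" where
  "x_part = lin_ext word_poly"

text \<open>A linear section of \<^const>\<open>x_part\<close>, multiplicative only modulo the commutation relations
  of the \<open>X i\<close>.\<close>

definition x_lift :: "nat \<Rightarrow> ((nat \<Rightarrow>\<^sub>0 nat) \<Rightarrow>\<^sub>0 'k::comm_ring_1) \<Rightarrow> letter free_mon \<Rightarrow>\<^sub>0 'k" where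
  "x_lift n = lin_ext (\<lambda>m. Poly_Mapping.single (x_word n m) 1)"

lemma poly_elt_x_lift: "poly_elt q n p = q_ideal q n +>\<^bsub>free_alg n\<^esub> x_lift n p"
  by (simp add: poly_elt_def x_lift_def lin_ext_def mult_single)

lemma word_poly_in_comm_poly_ring:
  assumes "set (letters w) \<subseteq> X ` {..n} \<union> Y ` {..n}"
  shows "(word_poly w :: _ \<Rightarrow>\<^sub>0 'k::comm_ring_1) \<in> carrier (comm_poly_ring n)"
proof -
  interpret cring "comm_poly_ring n :: ((nat \<Rightarrow>\<^sub>0 nat) \<Rightarrow>\<^sub>0 'k) ring"
    by (rule cring_comm_poly_ring)
  have l: "(letter_poly l :: _ \<Rightarrow>\<^sub>0 'k) \<in> carrier (comm_poly_ring n)"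
    if "l \<in> X ` {..n} \<union> Y ` {..n}" for l
    using that by (auto simp: comm_poly_ring_def)
  have "(prod_list (map letter_poly ls) :: _ \<Rightarrow>\<^sub>0 'k) \<in> carrier (comm_poly_ring n)"
    if "set ls \<subseteq> X ` {..n} \<union> Y ` {..n}" for ls
    using that
  proof (induction ls)
    case Nil
    then show ?case using one_closed by (simp add: comm_poly_ring_def)
  next
    case (Cons a ls)
    then show ?case
      using m_closed[OF l[of a], of "prod_list (map letter_poly ls)"]
      by (simp add: comm_poly_ring_def)
  qed
  with assms show ?thesis by (simp add: word_poly_def)
qed

lemma x_part_in_comm_poly_ring:
  fixes p :: "letter free_mon \<Rightarrow>\<^sub>0 'k::comm_ring_1"
  assumes "p \<in> carrier (free_alg n)"
  shows "x_part p \<in> carrier (comm_poly_ring n)"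
proof -
  interpret cring "comm_poly_ring n :: ((nat \<Rightarrow>\<^sub>0 nat) \<Rightarrow>\<^sub>0 'k) ring"
    by (rule cring_comm_poly_ring)
  show ?thesis
    unfolding x_part_def
  proof (rule lin_ext_mem_ideal)
    show "ideal (carrier (comm_poly_ring n :: (_ \<Rightarrow>\<^sub>0 'k) ring)) (monoid_alg {m. Poly_Mapping.keys m \<subseteq> {..n}})"
      using oneideal unfolding comm_poly_ring_def .
    show "(word_poly w :: _ \<Rightarrow>\<^sub>0 'k) \<in> carrier (comm_poly_ring n)"
      if "w \<in> Poly_Mapping.keys p" for w
      using that assms by (intro word_poly_in_comm_poly_ring) (auto simp: free_alg_def)
  qed simp
qed

lemma x_lift_in_free_alg: "(x_lift n p :: _ \<Rightarrow>\<^sub>0 'k::comm_ring_1) \<in> carrier (free_alg n)"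
proof -
  interpret ring "free_alg n :: (letter free_mon \<Rightarrow>\<^sub>0 'k) ring" by (rule ring_free_alg)
  show ?thesis
    unfolding x_lift_def
  proof (rule lin_ext_mem_ideal)
    show "ideal (carrier (free_alg n :: (_ \<Rightarrow>\<^sub>0 'k) ring)) (monoid_alg {w. set (letters w) \<subseteq> X ` {..n} \<union> Y ` {..n}})"
      using oneideal unfolding free_alg_def .
  qed (auto simp: free_alg_def x_word_def zero_free_mon_def)
qed

lemma x_part_hom:
  "x_part \<in> ring_hom (free_alg n :: (letter free_mon \<Rightarrow>\<^sub>0 'k::comm_ring_1) ring) (comm_poly_ring n)"
proof (rule ring_hom_memI)
  have "word_poly (u + v) = word_poly u * (word_poly v :: _ \<Rightarrow>\<^sub>0 'k)" for u v
    by (simp add: word_poly_def plus_free_mon_def)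
  then show "x_part (a \<otimes>\<^bsub>free_alg n\<^esub> b) = x_part a \<otimes>\<^bsub>comm_poly_ring n\<^esub> x_part b"
    for a b :: "letter free_mon \<Rightarrow>\<^sub>0 'k"
    by (simp add: x_part_def free_alg_def comm_poly_ring_def lin_ext_mult)
  have "x_part (Poly_Mapping.single 0 1) = (1 :: _ \<Rightarrow>\<^sub>0 'k)"
    unfolding x_part_def lin_ext_single by (simp add: word_poly_def zero_free_mon_def)
  then show "x_part \<one>\<^bsub>free_alg n\<^esub> = (\<one>\<^bsub>comm_poly_ring n\<^esub> :: _ \<Rightarrow>\<^sub>0 'k)"
    by (simp add: free_alg_def comm_poly_ring_def)
qed (simp_all add: x_part_in_comm_poly_ring, simp_all add: x_part_def free_alg_def comm_poly_ring_def lin_ext_add)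

lemma word_poly_x_word:
  assumes "Poly_Mapping.keys m \<subseteq> {..n}"
  shows "word_poly (x_word n m) = (Poly_Mapping.single m 1 :: _ \<Rightarrow>\<^sub>0 'k::comm_ring_1)"
proof -
  have pow: "Poly_Mapping.single (Poly_Mapping.single i (Suc 0)) 1 ^ e =
      (Poly_Mapping.single (Poly_Mapping.single i e) 1 :: (nat \<Rightarrow>\<^sub>0 nat) \<Rightarrow>\<^sub>0 'k)" for e i
    by (induction e) (simp_all add: mult_single single_add[symmetric])
  have "prod_list (map letter_poly (concat (map (\<lambda>i. replicate (Poly_Mapping.lookup m i) (X i)) [0..<N])))
      = (Poly_Mapping.single (\<Sum>i<N. Poly_Mapping.single i (Poly_Mapping.lookup m i)) 1 :: _ \<Rightarrow>\<^sub>0 'k)" for N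
    by (induction N) (simp_all add: pow mult_single add.commute)
  moreover have "(\<Sum>i<Suc n. Poly_Mapping.single i (Poly_Mapping.lookup m i)) = m"
  proof (rule poly_mapping_eqI)
    fix j
    have "Poly_Mapping.lookup (\<Sum>i<Suc n. Poly_Mapping.single i (Poly_Mapping.lookup m i)) j
        = (\<Sum>i<Suc n. if i = j then Poly_Mapping.lookup m j else 0)"
      unfolding lookup_sum by (rule sum.cong) (auto simp: lookup_single)
    also have "\<dots> = Poly_Mapping.lookup m j"
      using assms by (auto simp: sum.delta in_keys_iff less_Suc_eq_le)
    finally show "Poly_Mapping.lookup (\<Sum>i<Suc n. Poly_Mapping.single i (Poly_Mapping.lookup m i)) j
        = Poly_Mapping.lookup m j" .
  qed
  ultimately show ?thesis
    by (simp only: word_poly_def x_word_def free_mon.sel)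
qed

lemma x_part_x_lift:
  assumes "p \<in> carrier (comm_poly_ring n)"
  shows "x_part (x_lift n p) = p"
proof -
  have "x_part (x_lift n p) = lin_ext (\<lambda>m. word_poly (x_word n m)) p"
    unfolding x_part_def x_lift_def lin_ext_comp by simp
  also have "\<dots> = lin_ext (\<lambda>m. Poly_Mapping.single m 1) p"
    using assms by (intro lin_ext_cong word_poly_x_word) (auto simp: comm_poly_ring_def)
  finally show ?thesis by (simp add: lin_ext_monomials)
qed

section \<open>Normal forms modulo the relations and the second set of variables\<close>

lemma mset_x_word:
  "mset (letters (x_word n m)) = (\<Sum>i\<le>n. replicate_mset (Poly_Mapping.lookup m i) (X i))"
proof -
  have "mset (concat (map (\<lambda>i. replicate (Poly_Mapping.lookup m i) (X i)) [0..<N]))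
      = (\<Sum>i<N. replicate_mset (Poly_Mapping.lookup m i) (X i))" for N
    by (induction N) simp_all
  then show ?thesis
    unfolding x_word_def by (simp only: free_mon.sel lessThan_Suc_atMost)
qed

text \<open>A word in the \<open>X i\<close> is a rearrangement of the standard word of its monomial; the
  comparison by multisets avoids tracking where a new letter has to be inserted.\<close>

lemma X_word_monomial:
  assumes "set ws \<subseteq> X ` {..n}"
  shows "\<exists>m. Poly_Mapping.keys m \<subseteq> {..n} \<and> mset (letters (x_word n m)) = mset ws \<and>
    word_poly (Word ws) = (Poly_Mapping.single m 1 :: _ \<Rightarrow>\<^sub>0 'k::comm_ring_1)"
  using assms
proof (induction ws)
  case Nil
  show ?case
    by (intro exI[of _ 0]) (simp add: mset_x_word word_poly_def)
next
  case (Cons l ws)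
  then obtain m i where m: "Poly_Mapping.keys m \<subseteq> {..n}" "mset (letters (x_word n m)) = mset ws"
    "word_poly (Word ws) = (Poly_Mapping.single m 1 :: _ \<Rightarrow>\<^sub>0 'k)" and i: "l = X i" "i \<le> n"
    by auto
  let ?m = "Poly_Mapping.single i 1 + m"
  have "mset (letters (x_word n ?m)) =
      (\<Sum>j\<le>n. (if j = i then {#X i#} else {#}) + replicate_mset (Poly_Mapping.lookup m j) (X j))"
    unfolding mset_x_word by (rule sum.cong) (auto simp: lookup_add lookup_single)
  also have "\<dots> = add_mset (X i) (mset (letters (x_word n m)))"
    using i(2) by (simp add: sum.distrib mset_x_word sum.delta)
  finally have "mset (letters (x_word n ?m)) = mset (l # ws)"
    using m(2) i(1) by simp
  moreover have "Poly_Mapping.keys ?m \<subseteq> {..n}"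
    using keys_add[of "Poly_Mapping.single i 1" m] m(1) i(2) by auto
  moreover have "word_poly (Word (l # ws)) = (Poly_Mapping.single ?m 1 :: _ \<Rightarrow>\<^sub>0 'k)"
    using m(3) i(1) by (simp add: word_poly_def mult_single)
  ultimately show ?case by blast
qed

lemma single_word_closed:
  "set us \<subseteq> X ` {..n} \<union> Y ` {..n} \<Longrightarrow>
     (Poly_Mapping.single (Word us) 1 :: _ \<Rightarrow>\<^sub>0 'k::comm_ring_1) \<in> carrier (free_alg n)"
  by (simp add: free_alg_def)

lemma ideal_free_alg_sandwich:
  assumes K: "ideal K (free_alg n)" and a: "a \<in> K"
    and us: "set us \<subseteq> X ` {..n} \<union> Y ` {..n}" and vs: "set vs \<subseteq> X ` {..n} \<union> Y ` {..n}"
  shows "Poly_Mapping.single (Word us) 1 * a * Poly_Mapping.single (Word vs) (1::'k::comm_ring_1) \<in> K"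
proof -
  interpret K: ideal K "free_alg n" by (rule K)
  show ?thesis
    using K.I_r_closed[OF K.I_l_closed[OF a single_word_closed[OF us]] single_word_closed[OF vs]]
    by (simp add: free_alg_def)
qed

text \<open>Exchanging neighbours inside a word changes it by a multiple of a commutator, and a
  rearrangement is a composition of such exchanges: the first letter of one word is moved to the
  front of the other, and the rest is handled behind the common first letter.\<close>

lemma X_word_rearrange:
  fixes K :: "(letter free_mon \<Rightarrow>\<^sub>0 'k::comm_ring_1) set"
  assumes K: "ideal K (free_alg n)"
    and comm: "\<And>i j. i \<le> n \<Longrightarrow> j \<le> n \<Longrightarrow> gen (X i) * gen (X j) - gen (X j) * gen (X i) \<in> K"
    and xs: "set xs \<subseteq> X ` {..n}" and mset: "mset xs = mset ys"
  shows "Poly_Mapping.single (Word xs) 1 - Poly_Mapping.single (Word ys) 1 \<in> K"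
proof -
  interpret K: ideal K "free_alg n" by (rule K)
  define eqv :: "letter list \<Rightarrow> letter list \<Rightarrow> bool" where
    "eqv us vs \<longleftrightarrow> Poly_Mapping.single (Word us) 1 - Poly_Mapping.single (Word vs) 1 \<in> K" for us vs
  have refl: "eqv us us" for us
    using additive_subgroup.zero_closed[OF K.additive_subgroup_axioms] by (simp add: eqv_def free_alg_def)
  have trans: "eqv us ws" if "eqv us vs" "eqv vs ws" for us vs ws
    using additive_subgroup.a_closed[OF K.additive_subgroup_axioms that[unfolded eqv_def]] by (simp add: eqv_def free_alg_def)
  have swap: "eqv (us @ a # b # vs) (us @ b # a # vs)"
    if abs: "set (us @ a # b # vs) \<subseteq> X ` {..n}" for us vs a b
  proof -
    obtain i j where ij: "a = X i" "b = X j" "i \<le> n" "j \<le> n" using abs by auto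
    have "Poly_Mapping.single (Word us) 1 * (gen a * gen b - gen b * gen a) * Poly_Mapping.single (Word vs) 1 \<in> K"
      using abs ij comm by (intro ideal_free_alg_sandwich[OF K]) auto
    also have "Poly_Mapping.single (Word us) 1 * (gen a * gen b - gen b * gen a) * Poly_Mapping.single (Word vs) 1 =
      Poly_Mapping.single (Word (us @ a # b # vs)) (1::'k) - Poly_Mapping.single (Word (us @ b # a # vs)) 1"
      by (simp add: algebra_simps mult_single plus_free_mon_def)
    finally show ?thesis unfolding eqv_def .
  qed
  have move: "eqv (us @ a # vs @ ws) (us @ vs @ a # ws)"
    if "set (us @ a # vs @ ws) \<subseteq> X ` {..n}" for us a vs ws
    using that
  proof (induction vs arbitrary: us)
    case Nil
    then show ?case using refl by simp
  next
    case (Cons v vs)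
    have "eqv (us @ a # v # (vs @ ws)) (us @ v # a # (vs @ ws))"
      using Cons.prems by (intro swap) auto
    moreover have "eqv ((us @ [v]) @ a # vs @ ws) ((us @ [v]) @ vs @ a # ws)"
      using Cons.prems by (intro Cons.IH) auto
    ultimately show ?case using trans by simp
  qed
  \<comment> \<open>The prefix \<open>us\<close> collects the letters that already agree.\<close>
  have "eqv (us @ xs) (us @ ys)" if "set (us @ xs) \<subseteq> X ` {..n}" "mset xs = mset ys" for us xs ys
    using that
  proof (induction xs arbitrary: us ys)
    case Nil
    then show ?case using refl by simp
  next
    case (Cons a xs)
    have "a \<in> set ys" using Cons.prems(2) by (metis list.set_intros(1) mset_eq_setD)
    then obtain ys1 ys2 where ys: "ys = ys1 @ a # ys2" by (meson split_list)
    have xs: "mset xs = mset (ys1 @ ys2)" using Cons.prems(2) ys by simp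
    have "eqv ((us @ [a]) @ xs) ((us @ [a]) @ ys1 @ ys2)"
      using Cons.prems xs by (intro Cons.IH) auto
    moreover have "eqv (us @ a # ys1 @ ys2) (us @ ys1 @ a # ys2)"
      using Cons.prems mset_eq_setD[OF xs] by (intro move) auto
    ultimately show ?case using trans ys by simp
  qed
  from this[of "[]"] xs mset show ?thesis unfolding eqv_def by simp
qed

text \<open>A word that contains some \<open>Y i\<close> lies in the ideal and has commutative image zero; any
  other word is a rearrangement of its standard form.\<close>

lemma word_normal_form:
  fixes K :: "(letter free_mon \<Rightarrow>\<^sub>0 'k::comm_ring_1) set"
  assumes K: "ideal K (free_alg n)"
    and comm: "\<And>i j. i \<le> n \<Longrightarrow> j \<le> n \<Longrightarrow> gen (X i) * gen (X j) - gen (X j) * gen (X i) \<in> K"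
    and Y: "\<And>i. i \<le> n \<Longrightarrow> gen (Y i) \<in> K"
    and w: "set ws \<subseteq> X ` {..n} \<union> Y ` {..n}"
  shows "Poly_Mapping.single (Word ws) 1 - x_lift n (word_poly (Word ws)) \<in> K"
proof (cases "set ws \<subseteq> X ` {..n}")
  case True
  obtain m where m: "mset (letters (x_word n m)) = mset ws"
    "word_poly (Word ws) = (Poly_Mapping.single m 1 :: _ \<Rightarrow>\<^sub>0 'k)"
    using X_word_monomial[OF True] by blast
  then have "Poly_Mapping.single (Word ws) 1 - Poly_Mapping.single (Word (letters (x_word n m))) 1 \<in> K"
    by (intro X_word_rearrange[OF K comm True]) simp_all
  then show ?thesis by (simp add: m(2) x_lift_def)
next
  case False
  then obtain i where i: "Y i \<in> set ws" "i \<le> n" using w by blast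
  then obtain us vs where ws: "ws = us @ Y i # vs" by (meson split_list)
  have "word_poly (Word ws) = (0 :: _ \<Rightarrow>\<^sub>0 'k)"
    by (simp add: ws word_poly_def)
  moreover have "x_lift n 0 = (0 :: _ \<Rightarrow>\<^sub>0 'k)"
    by (simp add: x_lift_def lin_ext_def)
  moreover have "Poly_Mapping.single (Word ws) 1 =
      Poly_Mapping.single (Word us) 1 * gen (Y i) * Poly_Mapping.single (Word vs) (1::'k)"
    by (simp add: ws mult_single plus_free_mon_def)
  moreover have "Poly_Mapping.single (Word us) 1 * gen (Y i) * Poly_Mapping.single (Word vs) 1 \<in> K"
    using w ws i by (intro ideal_free_alg_sandwich[OF K Y]) auto
  ultimately show ?thesis by simp
qed

text \<open>Consequently the kernel of \<^const>\<open>x_part\<close> is contained in every ideal that contains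
  the commutators of the \<open>X i\<close> and all the \<open>Y i\<close>.\<close>

lemma normal_form:
  fixes K :: "(letter free_mon \<Rightarrow>\<^sub>0 'k::comm_ring_1) set"
  assumes K: "ideal K (free_alg n)"
    and comm: "\<And>i j. i \<le> n \<Longrightarrow> j \<le> n \<Longrightarrow> gen (X i) * gen (X j) - gen (X j) * gen (X i) \<in> K"
    and Y: "\<And>i. i \<le> n \<Longrightarrow> gen (Y i) \<in> K"
    and a: "a \<in> carrier (free_alg n)"
  shows "a - x_lift n (x_part a) \<in> K"
proof -
  have "a - x_lift n (x_part a) =
      lin_ext (\<lambda>w. Poly_Mapping.single w 1 - x_lift n (word_poly w)) a"
    by (simp add: lin_ext_diff lin_ext_monomials x_lift_def x_part_def lin_ext_comp)
  also have "\<dots> \<in> K"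
  proof (rule lin_ext_mem_ideal[OF K[unfolded free_alg_def]])
    fix w assume "w \<in> Poly_Mapping.keys a"
    then have "set (letters w) \<subseteq> X ` {..n} \<union> Y ` {..n}"
      using a by (auto simp: free_alg_def)
    from word_normal_form[OF K comm Y this]
    show "Poly_Mapping.single w 1 - x_lift n (word_poly w) \<in> K" by simp
  qed (simp add: zero_free_mon_def)
  finally show ?thesis .
qed

section \<open>Contraction of ideals to the commutative polynomial ring\<close>

definition contraction ::
  "'k::comm_ring_1 \<Rightarrow> nat \<Rightarrow> (letter free_mon \<Rightarrow>\<^sub>0 'k) set set \<Rightarrow> ((nat \<Rightarrow>\<^sub>0 nat) \<Rightarrow>\<^sub>0 'k) set" where
  "contraction q n Q = {p \<in> carrier (comm_poly_ring n). poly_elt q n p \<in> Q}"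

lemma ring_hom_coset: "ring_hom_ring (free_alg n) (q_alg q n) ((+>\<^bsub>free_alg n\<^esub>) (q_ideal q n))"
  unfolding q_alg_def by (rule ideal.rcos_ring_hom_ring[OF ideal_q_ideal])

lemma coset_of_q_relation:
  assumes "r \<in> q_relations q n"
  shows "q_ideal q n +>\<^bsub>free_alg n\<^esub> r = \<zero>\<^bsub>q_alg q n\<^esub>"
proof -
  have "r \<in> q_ideal q n"
    unfolding q_ideal_def
    by (rule subsetD[OF ring.genideal_self[OF ring_free_alg q_relations_closed] assms])
  then have "q_ideal q n +>\<^bsub>free_alg n\<^esub> r = q_ideal q n"
    by (rule ring.a_rcos_zero[OF ring_free_alg ideal_q_ideal])
  then show ?thesis
    by (simp only: q_alg_def FactRing_def ring.simps)
qed

text \<open>The preimage of such an ideal in the free algebra contains the relations and the \<open>Y i\<close>,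
  hence it does not distinguish an element from the normal form of that element. Thus it is the
  full preimage of the contraction under \<^const>\<open>x_part\<close>.\<close>

lemma coset_mem_iff_x_part:
  fixes q :: "'k::comm_ring_1"
  assumes Q: "ideal Q (q_alg q n)" and y: "y_elt q n ` {0..n} \<subseteq> Q"
    and a: "a \<in> carrier (free_alg n)"
  shows "q_ideal q n +>\<^bsub>free_alg n\<^esub> a \<in> Q \<longleftrightarrow> x_part a \<in> contraction q n Q"
proof -
  interpret \<pi>: ring_hom_ring "free_alg n" "q_alg q n" "(+>\<^bsub>free_alg n\<^esub>) (q_ideal q n)"
    by (rule ring_hom_coset)
  interpret Q: ideal Q "q_alg q n" by (rule Q)
  define K where "K = {r \<in> carrier (free_alg n). q_ideal q n +>\<^bsub>free_alg n\<^esub> r \<in> Q}"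
  have K: "ideal K (free_alg n)" unfolding K_def by (rule \<pi>.ideal_vimage[OF Q])
  interpret K: ideal K "free_alg n" by (rule K)
  have rel: "r \<in> K" if r: "r \<in> q_relations q n" for r
  proof -
    have "q_ideal q n +>\<^bsub>free_alg n\<^esub> r \<in> Q"
      unfolding coset_of_q_relation[OF r] by (rule Q.zero_closed)
    then show ?thesis
      unfolding K_def using subsetD[OF q_relations_closed r] by (intro CollectI conjI)
  qed
  have nf: "a - x_lift n (x_part a) \<in> K"
  proof (rule normal_form[OF K _ _ a])
    show "gen (X i) * gen (X j) - gen (X j) * gen (X i) \<in> K" if "i \<le> n" "j \<le> n" for i j
      using that by (intro rel) (auto simp: q_relations_def)
    show "gen (Y i) \<in> K" if "i \<le> n" for i
      using that y gen_closed(2)[OF that] unfolding K_def y_elt_def by auto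
  qed
  have "a \<in> K \<longleftrightarrow> x_lift n (x_part a) \<in> K"
  proof
    assume "a \<in> K"
    from monoid_alg_minus_closed[OF K[unfolded free_alg_def] this nf]
    show "x_lift n (x_part a) \<in> K" by simp
  next
    assume "x_lift n (x_part a) \<in> K"
    from K.a_closed[OF nf this] show "a \<in> K" by (simp add: free_alg_def)
  qed
  with a x_lift_in_free_alg[of n "x_part a"] x_part_in_comm_poly_ring[OF a] show ?thesis
    unfolding K_def contraction_def poly_elt_x_lift mem_Collect_eq by blast
qed

text \<open>The map \<^const>\<open>poly_elt\<close> is a homomorphism only because the \<open>X i\<close> commute in the
  quotient. Describing the contraction as the image of an ideal under the surjective homomorphism
  \<^const>\<open>x_part\<close> avoids proving this separately.\<close>

lemma ideal_contraction:
  fixes q :: "'k::comm_ring_1"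
  assumes Q: "ideal Q (q_alg q n)" and y: "y_elt q n ` {0..n} \<subseteq> Q"
  shows "ideal (contraction q n Q) (comm_poly_ring n)"
proof -
  interpret \<pi>: ring_hom_ring "free_alg n" "q_alg q n" "(+>\<^bsub>free_alg n\<^esub>) (q_ideal q n)"
    by (rule ring_hom_coset)
  interpret C: cring "comm_poly_ring n :: ((nat \<Rightarrow>\<^sub>0 nat) \<Rightarrow>\<^sub>0 'k) ring"
    by (rule cring_comm_poly_ring)
  interpret h: ring_hom_ring "free_alg n" "comm_poly_ring n" "x_part :: _ \<Rightarrow> _ \<Rightarrow>\<^sub>0 'k"
    by (rule ring_hom_ringI2[OF ring_free_alg C.ring_axioms x_part_hom])
  define K where "K = {r \<in> carrier (free_alg n). q_ideal q n +>\<^bsub>free_alg n\<^esub> r \<in> Q}"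
  have K: "ideal K (free_alg n)" unfolding K_def by (rule \<pi>.ideal_vimage[OF Q])
  interpret K: ideal K "free_alg n" by (rule K)
  have img: "contraction q n Q = x_part ` K"
  proof
    show "x_part ` K \<subseteq> contraction q n Q"
      using coset_mem_iff_x_part[OF Q y] unfolding K_def by blast
    show "contraction q n Q \<subseteq> x_part ` K"
    proof
      fix p assume p: "p \<in> contraction q n Q"
      then have "x_lift n p \<in> K"
        unfolding K_def contraction_def by (auto simp: poly_elt_x_lift x_lift_in_free_alg)
      moreover have "x_part (x_lift n p) = p"
        using p by (intro x_part_x_lift) (simp add: contraction_def)
      ultimately show "p \<in> x_part ` K" by (metis image_eqI)
    qed
  qed
  have r: "b \<otimes>\<^bsub>comm_poly_ring n\<^esub> p \<in> x_part ` K"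
    if p: "p \<in> x_part ` K" and b: "b \<in> carrier (comm_poly_ring n)" for p b
  proof -
    obtain a where a: "p = x_part a" "a \<in> K" using p by (rule imageE)
    have "x_lift n b \<otimes>\<^bsub>free_alg n\<^esub> a \<in> K"
      by (rule K.I_l_closed[OF a(2) x_lift_in_free_alg])
    then have "x_part (x_lift n b \<otimes>\<^bsub>free_alg n\<^esub> a) \<in> x_part ` K"
      by (rule imageI)
    then show ?thesis
      by (simp only: h.hom_mult[OF x_lift_in_free_alg K.Icarr[OF a(2)]] a(1) x_part_x_lift[OF b])
  qed
  have "subgroup (x_part ` K) (add_monoid (comm_poly_ring n))"
    by (rule h.img_is_add_subgroup[OF K.a_subgroup])
  moreover have "p \<otimes>\<^bsub>comm_poly_ring n\<^esub> b \<in> x_part ` K"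
    if "p \<in> x_part ` K" "b \<in> carrier (comm_poly_ring n)" for p b
  proof -
    have "p \<in> carrier (comm_poly_ring n)"
      using that(1) img unfolding contraction_def by blast
    with r[OF that] that(2) show ?thesis by (simp add: C.m_comm)
  qed
  ultimately show ?thesis
    unfolding img using r by (intro idealI C.ring_axioms)
qed

lemma primeideal_contraction:
  fixes q :: "'k::comm_ring_1"
  assumes P: "completely_prime_ideal P (q_alg q n)" and y: "y_elt q n ` {0..n} \<subseteq> P"
  shows "primeideal (contraction q n P) (comm_poly_ring n)"
proof (rule primeidealI)
  have Pid: "ideal P (q_alg q n)" using P by (simp add: completely_prime_ideal_def)
  show "ideal (contraction q n P) (comm_poly_ring n)" by (rule ideal_contraction[OF Pid y])
  show "cring (comm_poly_ring n :: ((nat \<Rightarrow>\<^sub>0 nat) \<Rightarrow>\<^sub>0 'k) ring)" by (rule cring_comm_poly_ring)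
  interpret \<pi>: ring_hom_ring "free_alg n" "q_alg q n" "(+>\<^bsub>free_alg n\<^esub>) (q_ideal q n)"
    by (rule ring_hom_coset)
  interpret P: ideal P "q_alg q n" by (rule Pid)
  note mem = coset_mem_iff_x_part[OF Pid y]
  show "carrier (comm_poly_ring n) \<noteq> contraction q n P"
  proof
    assume "carrier (comm_poly_ring n) = contraction q n P"
    then have "q_ideal q n +>\<^bsub>free_alg n\<^esub> \<one>\<^bsub>free_alg n\<^esub> \<in> P"
      using mem[OF \<pi>.R.one_closed] x_part_in_comm_poly_ring[OF \<pi>.R.one_closed] by blast
    then have "P = carrier (q_alg q n)"
      using P.one_imp_carrier \<pi>.hom_one by simp
    with P show False by (simp add: completely_prime_ideal_def)
  qed
  fix a b :: "(nat \<Rightarrow>\<^sub>0 nat) \<Rightarrow>\<^sub>0 'k"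
  assume a: "a \<in> carrier (comm_poly_ring n)" and b: "b \<in> carrier (comm_poly_ring n)"
    and ab: "a \<otimes>\<^bsub>comm_poly_ring n\<^esub> b \<in> contraction q n P"
  let ?ab = "x_lift n a \<otimes>\<^bsub>free_alg n\<^esub> x_lift n b"
  have "x_part ?ab = a \<otimes>\<^bsub>comm_poly_ring n\<^esub> b"
    by (simp only: ring_hom_mult[OF x_part_hom x_lift_in_free_alg x_lift_in_free_alg]
        x_part_x_lift[OF a] x_part_x_lift[OF b])
  then have "q_ideal q n +>\<^bsub>free_alg n\<^esub> ?ab \<in> P"
    using mem[of ?ab] ab \<pi>.R.m_closed[OF x_lift_in_free_alg x_lift_in_free_alg] by simp
  then have "poly_elt q n a \<otimes>\<^bsub>q_alg q n\<^esub> poly_elt q n b \<in> P"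
    using \<pi>.hom_mult[OF x_lift_in_free_alg x_lift_in_free_alg] by (simp add: poly_elt_x_lift)
  moreover have "poly_elt q n c \<in> carrier (q_alg q n)" for c
    unfolding poly_elt_x_lift by (rule \<pi>.hom_closed[OF x_lift_in_free_alg])
  ultimately show "a \<in> contraction q n P \<or> b \<in> contraction q n P"
    using P a b unfolding completely_prime_ideal_def contraction_def by blast
qed

text \<open>Ideals that contain the \<open>Y i\<close> are determined by their contractions, which is what makes
  generators of the contraction generate the ideal itself.\<close>

lemma ideal_le_if_contraction_le:
  assumes P: "ideal P (q_alg q n)" "y_elt q n ` {0..n} \<subseteq> P"
    and Q: "ideal Q (q_alg q n)" "y_elt q n ` {0..n} \<subseteq> Q"
    and le: "contraction q n P \<subseteq> contraction q n Q"
  shows "P \<subseteq> Q"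
proof
  fix A assume A: "A \<in> P"
  then have "A \<in> carrier (q_alg q n)" by (rule ideal.Icarr[OF P(1)])
  then obtain a where a: "a \<in> carrier (free_alg n)" "A = q_ideal q n +>\<^bsub>free_alg n\<^esub> a"
    unfolding q_alg_def FactRing_def A_RCOSETS_def' by auto
  then have "x_part a \<in> contraction q n Q"
    using coset_mem_iff_x_part[OF P a(1)] A le by blast
  then show "A \<in> Q"
    using coset_mem_iff_x_part[OF Q a(1)] a(2) by blast
qed

section \<open>Prime ideals containing the second set of variables\<close>

theorem theorem4:
  fixes q :: "'k::field" and n :: nat and P :: "(letter free_mon \<Rightarrow>\<^sub>0 'k) set set"
  assumes q_nonzero: "q \<noteq> 0"
    and q_not_root_of_unity: "\<forall>r::nat. r > 0 \<longrightarrow> q ^ r \<noteq> 1"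
    and P_prime: "completely_prime_ideal P (q_alg q n)"
    and y_in_P: "Idl\<^bsub>q_alg q n\<^esub> (y_elt q n ` {0..n}) \<subseteq> P"
  shows "\<exists>(m::nat) (\<psi> :: nat \<Rightarrow> (nat \<Rightarrow>\<^sub>0 nat) \<Rightarrow>\<^sub>0 'k).
           (\<forall>i\<in>{1..m}. \<psi> i \<in> carrier (comm_poly_ring n)) \<and>
           primeideal (Idl\<^bsub>comm_poly_ring n\<^esub> (\<psi> ` {1..m})) (comm_poly_ring n) \<and>
           P = Idl\<^bsub>q_alg q n\<^esub> ((\<lambda>i. poly_elt q n (\<psi> i)) ` {1..m} \<union> y_elt q n ` {0..n})"
proof -
  interpret \<pi>: ring_hom_ring "free_alg n" "q_alg q n" "(+>\<^bsub>free_alg n\<^esub>) (q_ideal q n)"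
    by (rule ring_hom_coset)
  interpret C: noetherian_ring "comm_poly_ring n :: ((nat \<Rightarrow>\<^sub>0 nat) \<Rightarrow>\<^sub>0 'k) ring"
    by (rule hilbert_basis)
  have Pid: "ideal P (q_alg q n)"
    using P_prime by (simp add: completely_prime_ideal_def)
  have y_carr: "y_elt q n ` {0..n} \<subseteq> carrier (q_alg q n)"
    unfolding y_elt_def by (auto intro!: \<pi>.hom_closed gen_closed)
  have y: "y_elt q n ` {0..n} \<subseteq> P"
    using \<pi>.S.genideal_self[OF y_carr] y_in_P by blast
  let ?J = "contraction q n P"
  have Jprime: "primeideal ?J (comm_poly_ring n)"
    by (rule primeideal_contraction[OF P_prime y])
  obtain G where G: "G \<subseteq> carrier (comm_poly_ring n)" "finite G" "?J = Idl\<^bsub>comm_poly_ring n\<^esub> G"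
    using C.finetely_gen[OF ideal_contraction[OF Pid y]] by blast
  obtain \<psi> where \<psi>: "bij_betw \<psi> {1..card G} G"
    using ex_bij_betw_nat_finite_1[OF G(2)] by blast
  then have img: "\<psi> ` {1..card G} = G" by (rule bij_betw_imp_surj_on)
  let ?S = "(\<lambda>i. poly_elt q n (\<psi> i)) ` {1..card G} \<union> y_elt q n ` {0..n}"
  have S: "?S = poly_elt q n ` G \<union> y_elt q n ` {0..n}"
    using img by (simp flip: image_image[of "poly_elt q n" \<psi>])
  have GJ: "G \<subseteq> ?J" using C.genideal_self[OF G(1)] G(3) by simp
  then have SP: "?S \<subseteq> P" unfolding S using y by (auto simp: contraction_def)
  then have S_carr: "?S \<subseteq> carrier (q_alg q n)" using ideal.Icarr[OF Pid] by blast
  let ?Q = "Idl\<^bsub>q_alg q n\<^esub> ?S"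
  have Q: "ideal ?Q (q_alg q n)" by (rule \<pi>.S.genideal_ideal[OF S_carr])
  have SQ: "?S \<subseteq> ?Q" by (rule \<pi>.S.genideal_self[OF S_carr])
  then have yQ: "y_elt q n ` {0..n} \<subseteq> ?Q" by blast
  have "G \<subseteq> contraction q n ?Q"
    using SQ G(1) unfolding S contraction_def by blast
  then have "?J \<subseteq> contraction q n ?Q"
    unfolding G(3) by (rule C.genideal_minimal[OF ideal_contraction[OF Q yQ]])
  then have "P \<subseteq> ?Q" by (rule ideal_le_if_contraction_le[OF Pid y Q yQ])
  moreover have "?Q \<subseteq> P" by (rule \<pi>.S.genideal_minimal[OF Pid SP])
  ultimately have "P = ?Q" by blast
  moreover have "\<forall>i\<in>{1..card G}. \<psi> i \<in> carrier (comm_poly_ring n)"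
    using img G(1) by blast
  moreover have "primeideal (Idl\<^bsub>comm_poly_ring n\<^esub> (\<psi> ` {1..card G})) (comm_poly_ring n)"
    using Jprime by (simp only: img G(3))
  ultimately show ?thesis by blast
qed

end
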